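(* Every outerplanar graph $G$ of girth $g\ge6$ is PCF $4$-colorable, i.e. satisfies $\chi_{\rm pcf}(G)\le 4$.
   Context: All graphs are simple, finite and undirected. A vertex coloring of a graph is proper if adjacent vertices get distinct colors. It is conflict-free (with respect to open neighborhoods) if for every non-isolated vertex $x$ there is a color that appears exactly once on the open neighborhood $N(x)$. A PCF $k$-coloring is a vertex coloring with at most $k$ colors that is both proper and conflict-free. The PCF chromatic number $\chi_{\rm pcf}(G)$ is the minimum $k$ for which $G$ admits a PCF $k$-coloring. The girth of $G$ is the length of a shortest cycle in $G$ (infinite if $G$ has no cycle). *)

theory Defs
  imports "HOL-Analysis.Analysis" "HOL-Library.Extended_Nat"
begin

locale simple_graph =
  fixes V :: "'a set" and E :: "'a set set"
  assumes finite_vertices: "finite V"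
    and edge_subset: "e \<in> E \<Longrightarrow> e \<subseteq> V"
    and edge_card: "e \<in> E \<Longrightarrow> card e = 2"

definition neighborhood :: "'a set set \<Rightarrow> 'a \<Rightarrow> 'a set" where
  "neighborhood E x = {y. {x, y} \<in> E}"

text \<open>A cycle is given by the list of its vertices in cyclic order, so that its length (number of
  edges) is the length of the list.\<close>

definition is_cycle :: "'a set set \<Rightarrow> 'a list \<Rightarrow> bool" where
  "is_cycle E xs \<longleftrightarrow> length xs \<ge> 3 \<and> distinct xs \<and>
     (\<forall>i < length xs. {xs ! i, xs ! (Suc i mod length xs)} \<in> E)"

text \<open>For an acyclic graph this is the infimum of the empty set, that is, \<open>\<infinity>\<close>.\<close>

definition girth :: "'a set set \<Rightarrow> enat" where
  "girth E = (INF xs \<in> {xs. is_cycle E xs}. enat (length xs))"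

text \<open>A plane drawing places vertex \<open>v\<close> at the point \<open>p v\<close> and draws edge \<open>e\<close> as the arc \<open>\<gamma> e\<close>
  joining the images of its two ends (in either direction). The interior of an arc contains no
  vertex and no point of another arc.\<close>

definition plane_drawing ::
  "'a set \<Rightarrow> 'a set set \<Rightarrow> ('a \<Rightarrow> complex) \<Rightarrow> ('a set \<Rightarrow> real \<Rightarrow> complex) \<Rightarrow> bool" where
  "plane_drawing V E p \<gamma> \<longleftrightarrow>
     inj_on p V \<and>
     (\<forall>e\<in>E. arc (\<gamma> e) \<and> {pathstart (\<gamma> e), pathfinish (\<gamma> e)} = p ` e) \<and>
     (\<forall>e\<in>E. (path_image (\<gamma> e) - p ` e) \<inter> p ` V = {}) \<and>
     (\<forall>e\<in>E. \<forall>f\<in>E. e \<noteq> f \<longrightarrow> (path_image (\<gamma> e) - p ` e) \<inter> path_image (\<gamma> f) = {})"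

definition drawing_image ::
  "'a set \<Rightarrow> 'a set set \<Rightarrow> ('a \<Rightarrow> complex) \<Rightarrow> ('a set \<Rightarrow> real \<Rightarrow> complex) \<Rightarrow> complex set" where
  "drawing_image V E p \<gamma> = p ` V \<union> (\<Union>e\<in>E. path_image (\<gamma> e))"

text \<open>The drawing of a finite graph is compact, so its complement has exactly one unbounded
  component, the outer face; this is what \<^const>\<open>outside\<close> denotes.\<close>

definition outerplanar :: "'a set \<Rightarrow> 'a set set \<Rightarrow> bool" where
  "outerplanar V E \<longleftrightarrow>
     (\<exists>p \<gamma>. plane_drawing V E p \<gamma> \<and>
        (\<forall>v\<in>V. p v \<in> frontier (outside (drawing_image V E p \<gamma>))))"

definition proper_coloring :: "'a set set \<Rightarrow> ('a \<Rightarrow> 'c) \<Rightarrow> bool" where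
  "proper_coloring E c \<longleftrightarrow> (\<forall>u v. {u, v} \<in> E \<longrightarrow> c u \<noteq> c v)"

definition conflict_free_coloring :: "'a set \<Rightarrow> 'a set set \<Rightarrow> ('a \<Rightarrow> 'c) \<Rightarrow> bool" where
  "conflict_free_coloring V E c \<longleftrightarrow>
     (\<forall>x\<in>V. neighborhood E x \<noteq> {} \<longrightarrow> (\<exists>a. \<exists>!y. y \<in> neighborhood E x \<and> c y = a))"

definition pcf_colorable :: "'a set \<Rightarrow> 'a set set \<Rightarrow> nat \<Rightarrow> bool" where
  "pcf_colorable V E k \<longleftrightarrow>
     (\<exists>c :: 'a \<Rightarrow> nat. c ` V \<subseteq> {..<k} \<and> proper_coloring E c \<and> conflict_free_coloring V E c)"

definition pcf_chromatic_number :: "'a set \<Rightarrow> 'a set set \<Rightarrow> nat" where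
  "pcf_chromatic_number V E = (LEAST k. pcf_colorable V E k)"

text \<open>The minimum is attained: an injective coloring is proper and conflict-free.\<close>

lemma (in simple_graph) pcf_colorable_card: "pcf_colorable V E (card V)"
proof -
  obtain c :: "'a \<Rightarrow> nat" where c: "inj_on c V" "c ` V = {..<card V}"
    using ex_bij_betw_finite_nat[OF finite_vertices]
    by (auto simp: bij_betw_def atLeast0LessThan)
  have uv: "u \<in> V \<and> v \<in> V \<and> u \<noteq> v" if "{u, v} \<in> E" for u v
    using edge_subset[OF that] edge_card[OF that] by auto
  have "proper_coloring E c"
    unfolding proper_coloring_def using uv c(1) by (metis inj_onD)
  moreover have "conflict_free_coloring V E c"
    unfolding conflict_free_coloring_def
  proof (intro ballI impI)
    fix x assume "neighborhood E x \<noteq> {}"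
    then obtain y where y: "y \<in> neighborhood E x" by blast
    have "neighborhood E x \<subseteq> V"
      using uv by (auto simp: neighborhood_def)
    then have "\<exists>!z. z \<in> neighborhood E x \<and> c z = c y"
      using y c(1) by (metis inj_onD subsetD)
    then show "\<exists>a. \<exists>!y. y \<in> neighborhood E x \<and> c y = a" by blast
  qed
  ultimately show ?thesis
    unfolding pcf_colorable_def using c(2) by blast
qed

lemma (in simple_graph) pcf_chromatic_number_le_iff:
  "pcf_chromatic_number V E \<le> k \<longleftrightarrow> pcf_colorable V E k"
proof
  assume le: "pcf_chromatic_number V E \<le> k"
  have "pcf_colorable V E (pcf_chromatic_number V E)"
    unfolding pcf_chromatic_number_def using pcf_colorable_card by (rule LeastI)
  moreover have "{..<pcf_chromatic_number V E} \<subseteq> {..<k}"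
    using le by auto
  ultimately show "pcf_colorable V E k"
    unfolding pcf_colorable_def by (meson subset_trans)
next
  assume "pcf_colorable V E k"
  then show "pcf_chromatic_number V E \<le> k"
    unfolding pcf_chromatic_number_def by (rule Least_le)
qed

end

theory Submission
  imports Defs "HOL-Complex_Analysis.Winding_Numbers"
begin

text \<open>In an outerplanar drawing no two vertices are joined by three internally disjoint paths that
  all have an inner vertex: one of the three arcs would lie inside the closed curve formed by the
  other two, and its inner vertices would be off the outer face. Take such a graph without vertices
  of degree at most one, and a smallest nonempty vertex set \<open>S\<close> whose outside neighbors are contained
  in one vertex or in one edge \<open>uv\<close>. A shortest path from \<open>u\<close> to \<open>v\<close> through \<open>S\<close> closes to a cycle of
  length at least six, and it exhausts \<open>S\<close>: the attachments on the cycle of a component of the rest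
  either lie in a vertex or an edge, against minimality, or include two nonadjacent vertices, which
  gives three forbidden paths. So there are four consecutive vertices of degree two. These, and
  vertices of degree at most one, can be removed, and any PCF 4-coloring of the rest extends: each
  remaining neighbor only forbids its own color and one color that it sees exactly once.\<close>

section \<open>Theta curves\<close>

lemma inside_imp_notin: "z \<in> inside S \<Longrightarrow> z \<notin> S"
  by (simp add: inside_def)

lemma inside_subset_Compl_Un:
  assumes "C \<inter> inside (A \<union> B) = {}"
  shows "inside (A \<union> B) \<subseteq> - (A \<union> B \<union> C)"
proof
  fix z assume z: "z \<in> inside (A \<union> B)"
  then have "z \<notin> A \<union> B" by (rule inside_imp_notin)
  moreover have "z \<notin> C" using assms z by (metis disjoint_iff)
  ultimately show "z \<in> - (A \<union> B \<union> C)" by simp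
qed

text \<open>Both Jordan domains are connected and, by \<open>d2\<close> and \<open>d3\<close>, miss
  the whole theta curve. If they shared a point, each would be contained in the other, so the two
  domains and hence their frontiers would coincide, which the third arc prevents.\<close>

lemma theta_insides_not_overlap:
  fixes g1 g2 g3 :: "real \<Rightarrow> complex"
  assumes g1: "arc g1" "pathstart g1 = s" "pathfinish g1 = t"
    and g2: "arc g2" "pathstart g2 = s" "pathfinish g2 = t"
    and g3: "arc g3" "pathstart g3 = s" "pathfinish g3 = t"
    and i12: "path_image g1 \<inter> path_image g2 \<subseteq> {s, t}"
    and i13: "path_image g1 \<inter> path_image g3 \<subseteq> {s, t}"
    and i23: "path_image g2 \<inter> path_image g3 \<subseteq> {s, t}"
    and d3: "path_image g3 \<inter> inside (path_image g1 \<union> path_image g2) = {}"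
    and d2: "path_image g2 \<inter> inside (path_image g1 \<union> path_image g3) = {}"
  shows "inside (path_image g1 \<union> path_image g2) \<inter> inside (path_image g1 \<union> path_image g3) = {}"
proof (rule ccontr)
  let ?J2 = "inside (path_image g1 \<union> path_image g2)"
  let ?J3 = "inside (path_image g1 \<union> path_image g3)"
  assume "?J2 \<inter> ?J3 \<noteq> {}"
  then obtain z where z: "z \<in> ?J2" "z \<in> ?J3" by blast
  have "simple_path (g1 +++ reversepath g2)" "simple_path (g1 +++ reversepath g3)"
    using g1 g2 g3 i12 i13 by (auto intro!: simple_path_join_loop simp: arc_reversepath)
  then have J2: "connected ?J2" "frontier ?J2 = path_image g1 \<union> path_image g2"
    and J3: "connected ?J3" "frontier ?J3 = path_image g1 \<union> path_image g3"
    using Jordan_inside_outside[of "g1 +++ reversepath g2"]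
      Jordan_inside_outside[of "g1 +++ reversepath g3"] g1 g2 g3
    by (simp_all add: path_image_join)
  have "?J2 \<subseteq> ?J3"
  proof
    fix w assume "w \<in> ?J2"
    moreover have "?J2 \<subseteq> - (path_image g1 \<union> path_image g3)"
      using inside_subset_Compl_Un[OF d3] by (simp add: subset_iff)
    ultimately have "connected_component (- (path_image g1 \<union> path_image g3)) z w"
      using z(1) by (intro connected_componentI[OF J2(1)])
    then show "w \<in> ?J3" using z(2) by (rule inside_same_component)
  qed
  moreover have "?J3 \<subseteq> ?J2"
  proof
    fix w assume "w \<in> ?J3"
    moreover have "?J3 \<subseteq> - (path_image g1 \<union> path_image g2)"
      using inside_subset_Compl_Un[OF d2] by (simp add: subset_iff)
    ultimately have "connected_component (- (path_image g1 \<union> path_image g2)) z w"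
      using z(2) by (intro connected_componentI[OF J3(1)])
    then show "w \<in> ?J2" using z(1) by (rule inside_same_component)
  qed
  ultimately have "?J2 = ?J3" by (rule subset_antisym)
  \<comment> \<open>Equal frontiers put \<open>g2\<close> into the union of \<open>g1\<close> and
    \<open>g3\<close>, hence into \<open>{s, t}\<close>. A finite connected set is a single point,
    while an arc has two distinct ends.\<close>
  then have "path_image g1 \<union> path_image g2 = path_image g1 \<union> path_image g3"
    using J2(2) J3(2) by (metis (no_types))
  then have "path_image g2 \<subseteq> {s, t}" using i12 i23 by blast
  then have "finite (path_image g2)" by (rule finite_subset) simp
  then have "\<exists>a. path_image g2 = {a}"
    using connected_finite_iff_sing[OF connected_path_image[OF arc_imp_path[OF g2(1)]]] by simp
  moreover have "s \<in> path_image g2" "t \<in> path_image g2" "s \<noteq> t"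
    using g2 arc_distinct_ends[OF g2(1)] pathstart_in_path_image[of g2]
      pathfinish_in_path_image[of g2] by auto
  ultimately show False by auto
qed

text \<open>If no arc were enclosed by the other two, then the three bounded Jordan domains would be
  pairwise disjoint; but the winding numbers of the three loops sum to zero.\<close>

lemma theta_arc_enclosed:
  fixes g1 g2 g3 :: "real \<Rightarrow> complex"
  assumes g1: "arc g1" "pathstart g1 = s" "pathfinish g1 = t"
    and g2: "arc g2" "pathstart g2 = s" "pathfinish g2 = t"
    and g3: "arc g3" "pathstart g3 = s" "pathfinish g3 = t"
    and i12: "path_image g1 \<inter> path_image g2 \<subseteq> {s, t}"
    and i13: "path_image g1 \<inter> path_image g3 \<subseteq> {s, t}"
    and i23: "path_image g2 \<inter> path_image g3 \<subseteq> {s, t}"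
  shows "path_image g1 \<inter> inside (path_image g2 \<union> path_image g3) \<noteq> {}
    \<or> path_image g2 \<inter> inside (path_image g1 \<union> path_image g3) \<noteq> {}
    \<or> path_image g3 \<inter> inside (path_image g1 \<union> path_image g2) \<noteq> {}"
proof (rule ccontr)
  assume "\<not> ?thesis"
  then have d1: "path_image g1 \<inter> inside (path_image g2 \<union> path_image g3) = {}"
    and d2: "path_image g2 \<inter> inside (path_image g1 \<union> path_image g3) = {}"
    and d3: "path_image g3 \<inter> inside (path_image g1 \<union> path_image g2) = {}" by auto
  have sp: "simple_path (g1 +++ reversepath g2)" "simple_path (g1 +++ reversepath g3)"
      "simple_path (g2 +++ reversepath g3)"
    using g1 g2 g3 i12 i13 i23 by (auto intro!: simple_path_join_loop simp: arc_reversepath)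
  have pim: "path_image (g1 +++ reversepath g2) = path_image g1 \<union> path_image g2"
      "path_image (g1 +++ reversepath g3) = path_image g1 \<union> path_image g3"
      "path_image (g2 +++ reversepath g3) = path_image g2 \<union> path_image g3"
    using g1 g2 g3 by (simp_all add: path_image_join)
  have "inside (path_image g1 \<union> path_image g2) \<noteq> {}"
    using Jordan_inside_outside[OF sp(1)] pim g1 g2 by simp
  then obtain z where z: "z \<in> inside (path_image g1 \<union> path_image g2)" by blast
  have zn: "z \<notin> path_image g1" "z \<notin> path_image g2" "z \<notin> path_image g3"
    using z inside_subset_Compl_Un[OF d3] by (simp_all add: subset_iff)
  have z13: "z \<notin> inside (path_image g1 \<union> path_image g3)"
    using theta_insides_not_overlap[OF g1 g2 g3 i12 i13 i23 d3 d2] z by blast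
  \<comment> \<open>The preceding lemma with \<open>g1\<close> and \<open>g2\<close>
    interchanged.\<close>
  have z23: "z \<notin> inside (path_image g2 \<union> path_image g3)"
    using theta_insides_not_overlap[OF g2 g1 g3 _ i23 i13] i12 d1 d3 z
    by (auto simp: Un_commute Int_commute)
  have p: "path g1" "path g2" "path g3" using g1 g2 g3 by (auto intro: arc_imp_path)
  have wn: "winding_number (g1 +++ reversepath g2) z = winding_number g1 z - winding_number g2 z"
      "winding_number (g1 +++ reversepath g3) z = winding_number g1 z - winding_number g3 z"
      "winding_number (g2 +++ reversepath g3) z = winding_number g2 z - winding_number g3 z"
    using p zn g1 g2 g3 by (simp_all add: winding_number_join winding_number_reversepath)
  \<comment> \<open>Being neither on nor inside these two loops, \<open>z\<close> has winding number
    0 for both. Their difference is the winding number for the loop of \<open>g1\<close> and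
    \<open>g2\<close>, which is nonzero because \<open>z\<close> is inside it.\<close>
  have "z \<in> outside (path_image g1 \<union> path_image g3)" "z \<in> outside (path_image g2 \<union> path_image g3)"
    using z13 z23 zn inside_Un_outside[of "path_image g1 \<union> path_image g3"]
      inside_Un_outside[of "path_image g2 \<union> path_image g3"] by (metis ComplI Un_iff)+
  then have "winding_number (g1 +++ reversepath g3) z = 0" "winding_number (g2 +++ reversepath g3) z = 0"
    using sp pim g1 g2 g3
    by (auto intro!: winding_number_zero_in_outside simp: simple_path_imp_path)
  then have "winding_number (g1 +++ reversepath g2) z = 0" using wn by simp
  moreover have "winding_number (g1 +++ reversepath g2) z \<noteq> 0"
    using simple_closed_path_norm_winding_number_inside[OF sp(1), of z] z pim(1) by auto
  ultimately show False by blast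
qed

section \<open>Paths in plane drawings\<close>

fun path_edges :: "'a list \<Rightarrow> 'a set set" where
  "path_edges (x # y # xs) = insert {x, y} (path_edges (y # xs))"
| "path_edges _ = {}"

lemma path_edges_subset: "e \<in> path_edges xs \<Longrightarrow> e \<subseteq> set xs"
  by (induction xs rule: path_edges.induct) auto

lemma path_edges_subset_iff:
  "path_edges xs \<subseteq> E \<longleftrightarrow> successively (\<lambda>x y. {x, y} \<in> E) xs"
  by (induction xs rule: path_edges.induct) auto

lemma path_vertex_on_edge:
  "length xs \<ge> 2 \<Longrightarrow> v \<in> set xs \<Longrightarrow> \<exists>e\<in>path_edges xs. v \<in> e"
proof (induction xs rule: path_edges.induct)
  case (1 x y xs)
  then show ?case by (cases xs) auto
qed auto

text \<open>Since the path has an inner vertex, no edge of it joins \<open>a\<close> to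
  \<open>b\<close> directly. This is what later tells the edges of internally disjoint paths
  apart.\<close>

lemma path_edge_meets_interior:
  assumes "distinct (a # P @ [b])" "P \<noteq> []" "e \<in> path_edges (a # P @ [b])"
  shows "e \<inter> set P \<noteq> {}"
proof -
  \<comment> \<open>Without \<open>a\<close>, the first of the two ends of each edge along the list
    lies in \<open>P\<close>; only the edge at \<open>a\<close> then remains.\<close>
  have init: "e \<inter> set P \<noteq> {}" if "e \<in> path_edges (P @ [b])" "P \<noteq> []" for P
    using that
  proof (induction P rule: path_edges.induct)
    case (1 x y xs)
    then show ?case by auto
  qed auto
  obtain x xs where "P = x # xs" using assms(2) by (cases P) auto
  then show ?thesis using assms init[of P] by auto
qed

text \<open>The interior of either arc avoids the other arc, so a common point is the image of an
  end of \<open>e\<close> and of an end of \<open>f\<close>. Injectivity of \<open>p\<close> turns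
  this into a shared end.\<close>

lemma plane_drawing_edge_Int:
  assumes "plane_drawing V E p \<gamma>" "\<And>e. e \<in> E \<Longrightarrow> e \<subseteq> V" "e \<in> E" "f \<in> E" "e \<noteq> f"
  shows "path_image (\<gamma> e) \<inter> path_image (\<gamma> f) \<subseteq> p ` (e \<inter> f)"
proof -
  have "path_image (\<gamma> e) \<inter> path_image (\<gamma> f) \<subseteq> p ` e \<inter> p ` f"
    using assms unfolding plane_drawing_def by blast
  also have "\<dots> = p ` (e \<inter> f)"
    using assms unfolding plane_drawing_def by (metis inj_on_image_Int)
  finally show ?thesis .
qed

text \<open>The edge arcs are joined one after the other. As the first vertex does not recur in the
  list, the first arc meets the rest only at the joint, so the join is again an arc.\<close>

lemma arc_along_path:
  assumes pd: "plane_drawing V E p \<gamma>" and EV: "\<And>e. e \<in> E \<Longrightarrow> e \<subseteq> V"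
    and "distinct xs" "path_edges xs \<subseteq> E" "length xs \<ge> 2"
  obtains g where "arc g" "pathstart g = p (hd xs)" "pathfinish g = p (last xs)"
    "path_image g = (\<Union>e\<in>path_edges xs. path_image (\<gamma> e))"
proof -
  \<comment> \<open>A drawing leaves the direction of each edge arc open, so it may have to be
    reversed.\<close>
  have edge: "\<exists>g. arc g \<and> pathstart g = p x \<and> pathfinish g = p y \<and> path_image g = path_image (\<gamma> {x, y})"
    if "{x, y} \<in> E" for x y
  proof -
    have "arc (\<gamma> {x, y})" "{pathstart (\<gamma> {x, y}), pathfinish (\<gamma> {x, y})} = {p x, p y}"
      using pd that unfolding plane_drawing_def by auto
    then consider "pathstart (\<gamma> {x, y}) = p x" "pathfinish (\<gamma> {x, y}) = p y"
      | "pathstart (\<gamma> {x, y}) = p y" "pathfinish (\<gamma> {x, y}) = p x"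
      by (auto simp: doubleton_eq_iff)
    then show ?thesis
    proof cases
      case 1
      then show ?thesis using \<open>arc (\<gamma> {x, y})\<close> by blast
    next
      case 2
      then show ?thesis using \<open>arc (\<gamma> {x, y})\<close>
        by (intro exI[of _ "reversepath (\<gamma> {x, y})"]) (simp add: arc_reversepath)
    qed
  qed
  have "\<exists>g. arc g \<and> pathstart g = p (hd xs) \<and> pathfinish g = p (last xs)
      \<and> path_image g = (\<Union>e\<in>path_edges xs. path_image (\<gamma> e))"
    using assms(3-5)
  proof (induction xs rule: path_edges.induct)
    case (1 x y xs)
    obtain g1 where g1: "arc g1" "pathstart g1 = p x" "pathfinish g1 = p y"
      "path_image g1 = path_image (\<gamma> {x, y})"
      using edge 1 by (metis insert_subset path_edges.simps(1))
    show ?case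
    proof (cases xs)
      case Nil
      then show ?thesis using g1 by auto
    next
      case (Cons z zs)
      have "distinct (y # xs)" "path_edges (y # xs) \<subseteq> E" "length (y # xs) \<ge> 2"
        using 1 Cons by auto
      from "1.IH"[OF this] obtain g2 where g2: "arc g2" "pathstart g2 = p y"
        "pathfinish g2 = p (last (y # xs))"
        "path_image g2 = (\<Union>e\<in>path_edges (y # xs). path_image (\<gamma> e))" by auto
      have "path_image g1 \<inter> path_image (\<gamma> f) \<subseteq> {p y}" if f: "f \<in> path_edges (y # xs)" for f
      proof -
        have "f \<subseteq> set (y # xs)" using f path_edges_subset by blast
        then have "x \<notin> f" using 1 by auto
        then have "path_image (\<gamma> {x, y}) \<inter> path_image (\<gamma> f) \<subseteq> p ` ({x, y} \<inter> f)"
          using f 1 by (intro plane_drawing_edge_Int[OF pd EV]) auto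
        also have "\<dots> \<subseteq> {p y}" using \<open>x \<notin> f\<close> by auto
        finally show ?thesis using g1 by simp
      qed
      then have "path_image g1 \<inter> path_image g2 \<subseteq> {p y}" using g2(4) by blast
      then have "arc (g1 +++ g2)" using arc_join[OF g1(1) g2(1)] g1(3) g2(2) by simp
      moreover have "path_image (g1 +++ g2)
          = (\<Union>e\<in>path_edges (x # y # xs). path_image (\<gamma> e))"
        using g1 g2 by (simp add: path_image_join)
      ultimately show ?thesis using g1 g2 by (intro exI[of _ "g1 +++ g2"]) auto
    qed
  qed auto
  then show thesis using that by blast
qed

section \<open>Subdivisions of K_{2,3} in outerplanar drawings\<close>

text \<open>The lists hold only the inner vertices of three paths between the branch vertices
  \<open>a\<close> and \<open>b\<close>. They must be nonempty, which excludes a cycle with a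
  chord.\<close>

definition K23_subdivision :: "'a set set \<Rightarrow> 'a \<Rightarrow> 'a \<Rightarrow> 'a list \<Rightarrow> 'a list \<Rightarrow> 'a list \<Rightarrow> bool" where
  "K23_subdivision E a b P Q R \<longleftrightarrow>
     (\<forall>X\<in>{P, Q, R}. X \<noteq> [] \<and> distinct (a # X @ [b]) \<and> path_edges (a # X @ [b]) \<subseteq> E) \<and>
     set P \<inter> set Q = {} \<and> set P \<inter> set R = {} \<and> set Q \<inter> set R = {}"

text \<open>Without its ends the arc is connected and misses \<open>C\<close>, so meeting
  \<open>inside C\<close> it lies there entirely. An inner vertex of the path then has the open set
  \<open>inside C\<close> as a neighborhood. This set is disjoint from the outer face of the
  drawing, which contains \<open>C\<close>, so the vertex is not on the frontier of that
  face.\<close>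

lemma enclosed_path_not_outer:
  assumes pd: "plane_drawing V E p \<gamma>"
    and g: "arc g" "pathstart g = p a" "pathfinish g = p b"
    and gi: "path_image g = (\<Union>e\<in>path_edges (a # P @ [b]). path_image (\<gamma> e))"
    and P: "P \<noteq> []" "distinct (a # P @ [b])" "path_edges (a # P @ [b]) \<subseteq> E" "set (a # P @ [b]) \<subseteq> V"
    and disj: "path_image g \<inter> C \<subseteq> {p a, p b}"
    and meets: "path_image g \<inter> inside C \<noteq> {}"
    and C: "{p a, p b} \<subseteq> C" "closed C" "C \<subseteq> drawing_image V E p \<gamma>"
    and outer: "\<forall>v\<in>V. p v \<in> frontier (outside (drawing_image V E p \<gamma>))"
  shows False
proof -
  let ?I = "path_image g - {p a, p b}"
  have "connected ?I"
    using connected_simple_path_endless[OF arc_imp_simple_path[OF g(1)]] g by simp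
  moreover have "?I \<subseteq> - C" using disj by blast
  moreover obtain z where z: "z \<in> ?I" "z \<in> inside C"
    using meets C(1) by (auto dest: inside_imp_notin)
  ultimately have I: "?I \<subseteq> inside C"
    by (meson connected_componentI inside_same_component subsetI)
  obtain x where x: "x \<in> set P" using P(1) by (cases P) auto
  have inj: "inj_on p V" using pd unfolding plane_drawing_def by blast
  obtain e where e: "e \<in> path_edges (a # P @ [b])" "x \<in> e"
    using path_vertex_on_edge[of "a # P @ [b]" x] x by auto
  have "p ` e \<subseteq> path_image (\<gamma> e)"
    using pd e P(3) unfolding plane_drawing_def
    by (metis insert_subset empty_subsetI pathfinish_in_path_image pathstart_in_path_image subsetD)
  then have "p x \<in> path_image g" using e gi by auto
  moreover have "p x \<noteq> p a" "p x \<noteq> p b" using inj x P(2,4) by (auto simp: inj_on_eq_iff)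
  ultimately have px: "p x \<in> inside C" using I by blast
  have "inside C \<inter> outside (drawing_image V E p \<gamma>) = {}"
    using outside_mono[OF C(3)] inside_Int_outside[of C] by blast
  moreover have "open (inside C)" using C(2) by (rule open_inside)
  ultimately have "inside C \<inter> closure (outside (drawing_image V E p \<gamma>)) = {}"
    by (simp add: open_Int_closure_eq_empty)
  moreover have "p x \<in> closure (outside (drawing_image V E p \<gamma>))"
    using outer x P(4) by (auto simp: frontier_def)
  ultimately show False using px by blast
qed

text \<open>The three paths are drawn as a theta curve. One of its arcs enters the domain bounded by
  the other two, which contradicts that its inner vertices are on the outer face.\<close>

lemma outerplanar_no_K23_subdivision:
  assumes op: "outerplanar V E" and EV: "\<And>e. e \<in> E \<Longrightarrow> e \<subseteq> V"
  shows "\<not> K23_subdivision E a b P Q R"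
proof
  assume K: "K23_subdivision E a b P Q R"
  obtain p \<gamma> where pd: "plane_drawing V E p \<gamma>"
    and outer: "\<forall>v\<in>V. p v \<in> frontier (outside (drawing_image V E p \<gamma>))"
    using op unfolding outerplanar_def by blast
  let ?im = "\<lambda>X. \<Union>e\<in>path_edges (a # X @ [b]). path_image (\<gamma> e)"
  have arcs: "\<exists>g. arc g \<and> pathstart g = p a \<and> pathfinish g = p b \<and> path_image g = ?im X"
    if "X \<in> {P, Q, R}" for X
  proof -
    have "distinct (a # X @ [b])" "path_edges (a # X @ [b]) \<subseteq> E"
      using K that unfolding K23_subdivision_def by blast+
    then obtain g where "arc g" "pathstart g = p (hd (a # X @ [b]))"
      "pathfinish g = p (last (a # X @ [b]))" "path_image g = ?im X"
      using arc_along_path[OF pd EV, of "a # X @ [b]"] by (metis One_nat_def Suc_1 Suc_le_mono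
        append_is_Nil_conv le0 length_Cons length_greater_0_conv not_Cons_self2 Suc_leI)
    then show ?thesis by auto
  qed
  obtain g1 where g1: "arc g1" "pathstart g1 = p a" "pathfinish g1 = p b" "path_image g1 = ?im P"
    using arcs by blast
  obtain g2 where g2: "arc g2" "pathstart g2 = p a" "pathfinish g2 = p b" "path_image g2 = ?im Q"
    using arcs by blast
  obtain g3 where g3: "arc g3" "pathstart g3 = p a" "pathfinish g3 = p b" "path_image g3 = ?im R"
    using arcs by blast
  have disj: "?im X \<inter> ?im Y \<subseteq> {p a, p b}"
    if "X \<in> {P, Q, R}" "Y \<in> {P, Q, R}" "set X \<inter> set Y = {}" for X Y
  proof -
    have X: "X \<noteq> []" "distinct (a # X @ [b])" "path_edges (a # X @ [b]) \<subseteq> E"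
      and Y: "path_edges (a # Y @ [b]) \<subseteq> E" "distinct (a # Y @ [b])"
      using K that unfolding K23_subdivision_def by blast+
    have "path_image (\<gamma> e) \<inter> path_image (\<gamma> f) \<subseteq> {p a, p b}"
      if e: "e \<in> path_edges (a # X @ [b])" and f: "f \<in> path_edges (a # Y @ [b])" for e f
    proof -
      have ss: "e \<subseteq> insert a (insert b (set X))" "f \<subseteq> insert a (insert b (set Y))"
        using path_edges_subset[OF e] path_edges_subset[OF f] by auto
      \<comment> \<open>This end of \<open>e\<close> is inner to the first path and therefore not on
        the second, so \<open>e\<close> is not an edge of the second path.\<close>
      have "e \<inter> set X \<noteq> {}" using path_edge_meets_interior[OF X(2,1) e] .
      then have "e \<noteq> f" using ss X Y \<open>set X \<inter> set Y = {}\<close> by auto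
      then have "path_image (\<gamma> e) \<inter> path_image (\<gamma> f) \<subseteq> p ` (e \<inter> f)"
        using e f X Y by (intro plane_drawing_edge_Int[OF pd EV]) auto
      also have "\<dots> \<subseteq> {p a, p b}" using ss \<open>set X \<inter> set Y = {}\<close> by blast
      finally show ?thesis .
    qed
    then show ?thesis by blast
  qed
  have KK: "set P \<inter> set Q = {}" "set P \<inter> set R = {}" "set Q \<inter> set R = {}"
    using K unfolding K23_subdivision_def by blast+
  have i: "path_image g1 \<inter> path_image g2 \<subseteq> {p a, p b}"
    "path_image g1 \<inter> path_image g3 \<subseteq> {p a, p b}"
    "path_image g2 \<inter> path_image g3 \<subseteq> {p a, p b}"
    unfolding g1(4) g2(4) g3(4) using KK by (intro disj; simp)+
  have ends: "p a \<in> path_image g" "p b \<in> path_image g"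
    if "pathstart g = p a" "pathfinish g = p b" for g :: "real \<Rightarrow> complex"
    using that by (metis pathstart_in_path_image pathfinish_in_path_image)+
  \<comment> \<open>The roles are kept variable so that each of the three possible enclosed arcs is
    an instance.\<close>
  have enc: False
    if "X \<in> {P, Q, R}" "Y \<in> {P, Q, R}" "Z \<in> {P, Q, R}"
      and g: "arc g" "pathstart g = p a" "pathfinish g = p b" "path_image g = ?im X"
      and h: "arc h" "pathstart h = p a" "pathfinish h = p b" "path_image h = ?im Y"
      and k: "arc k" "pathstart k = p a" "pathfinish k = p b" "path_image k = ?im Z"
      and d: "path_image g \<inter> path_image h \<subseteq> {p a, p b}" "path_image g \<inter> path_image k \<subseteq> {p a, p b}"
      and m: "path_image g \<inter> inside (path_image h \<union> path_image k) \<noteq> {}"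
    for g h k X Y Z
  proof -
    have X: "X \<noteq> []" "distinct (a # X @ [b])" "path_edges (a # X @ [b]) \<subseteq> E"
      and Y: "path_edges (a # Y @ [b]) \<subseteq> E" and Z: "path_edges (a # Z @ [b]) \<subseteq> E"
      using K that(1-3) unfolding K23_subdivision_def by blast+
    have "set (a # X @ [b]) \<subseteq> V"
    proof
      fix v assume "v \<in> set (a # X @ [b])"
      then obtain e where "e \<in> path_edges (a # X @ [b])" "v \<in> e"
        using path_vertex_on_edge[of "a # X @ [b]" v] by auto
      then show "v \<in> V" using X(3) EV by blast
    qed
    moreover have "path_image h \<union> path_image k \<subseteq> drawing_image V E p \<gamma>"
      unfolding h(4) k(4) drawing_image_def using Y Z by blast
    moreover have "closed (path_image h \<union> path_image k)"
      by (intro closed_Un closed_path_image arc_imp_path h k)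
    moreover have "{p a, p b} \<subseteq> path_image h \<union> path_image k" using ends[OF h(2,3)] by blast
    moreover have "path_image g \<inter> (path_image h \<union> path_image k) \<subseteq> {p a, p b}" using d by blast
    ultimately show False
      using enclosed_path_not_outer[OF pd g X _ _ m] outer by blast
  qed
  have c: "P \<in> {P, Q, R}" "Q \<in> {P, Q, R}" "R \<in> {P, Q, R}" by auto
  have i': "path_image g2 \<inter> path_image g1 \<subseteq> {p a, p b}"
    "path_image g3 \<inter> path_image g1 \<subseteq> {p a, p b}"
    "path_image g3 \<inter> path_image g2 \<subseteq> {p a, p b}"
    using i by (simp_all only: Int_commute)
  show False
    using theta_arc_enclosed[OF g1(1-3) g2(1-3) g3(1-3) i]
      enc[OF c(1,2,3) g1 g2 g3 i(1,2)] enc[OF c(2,1,3) g2 g1 g3 i'(1) i(3)]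
      enc[OF c(3,1,2) g3 g1 g2 i'(2,3)] by (elim disjE)
qed

section \<open>Leaves and threads\<close>

text \<open>A walk of minimal length admits no shortcut: skipping a start segment, an end segment or
  the part below a chord would give a shorter walk of the same kind.\<close>

lemma shortest_walk:
  assumes "xs \<noteq> []" "set xs \<subseteq> X" "successively (\<lambda>x y. {x, y} \<in> E) xs"
    "{a, hd xs} \<in> E" "{last xs, b} \<in> E"
  obtains ys where "ys \<noteq> []" "set ys \<subseteq> X" "successively (\<lambda>x y. {x, y} \<in> E) ys"
    "{a, hd ys} \<in> E" "{last ys, b} \<in> E" "distinct ys"
    "\<And>i j. i < j \<Longrightarrow> j < length ys \<Longrightarrow> {ys ! i, ys ! j} \<in> E \<Longrightarrow> j = Suc i"
    "\<And>i. i < length ys \<Longrightarrow> {a, ys ! i} \<in> E \<Longrightarrow> i = 0"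
    "\<And>i. i < length ys \<Longrightarrow> {ys ! i, b} \<in> E \<Longrightarrow> Suc i = length ys"
proof -
  define W where "W ys \<longleftrightarrow> ys \<noteq> [] \<and> set ys \<subseteq> X \<and> successively (\<lambda>x y. {x, y} \<in> E) ys
    \<and> {a, hd ys} \<in> E \<and> {last ys, b} \<in> E" for ys
  have "W xs" using assms unfolding W_def by blast
  then obtain ys where ys: "W ys" and min: "\<And>zs. W zs \<Longrightarrow> length ys \<le> length zs"
    using ex_has_least_nat[of W xs length] by blast
  have succ: "successively (\<lambda>x y. {x, y} \<in> E) (take n ys)"
    "successively (\<lambda>x y. {x, y} \<in> E) (drop n ys)" for n
    using ys unfolding W_def by (metis append_take_drop_id successively_append_iff)+
  have sub: "set (take n ys) \<subseteq> X" "set (drop n ys) \<subseteq> X" for n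
    using ys set_take_subset[of n ys] set_drop_subset[of n ys] unfolding W_def by blast+
  have start: "i = 0" if "i < length ys" "{a, ys ! i} \<in> E" for i
  proof -
    have "W (drop i ys)"
      using that ys succ sub unfolding W_def by (simp add: hd_drop_conv_nth)
    from min[OF this] show ?thesis using that by simp
  qed
  have stop: "Suc i = length ys" if "i < length ys" "{ys ! i, b} \<in> E" for i
  proof -
    have l: "last (take (Suc i) ys) = ys ! i"
      using that by (simp add: take_Suc_conv_app_nth)
    have "W (take (Suc i) ys)"
      using that ys succ sub l unfolding W_def by simp
    from min[OF this] show ?thesis using that by simp
  qed
  have ind: "j = Suc i" if "i < j" "j < length ys" "{ys ! i, ys ! j} \<in> E" for i j
  proof -
    have l: "last (take (Suc i) ys) = ys ! i"
      using that by (simp add: take_Suc_conv_app_nth)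
    have "W (take (Suc i) ys @ drop j ys)"
      using that ys succ sub l unfolding W_def
      by (simp add: hd_drop_conv_nth successively_append_iff)
    from min[OF this] show ?thesis using that by simp
  qed
  \<comment> \<open>At a repetition, the edge entering the earlier occurrence, from \<open>a\<close>
    or from its predecessor, would also lead to the later one and be a shortcut.\<close>
  have "ys ! i \<noteq> ys ! j" if ij: "i < j" "j < length ys" for i j
  proof
    assume eq: "ys ! i = ys ! j"
    show False
    proof (cases i)
      case 0
      then have "{a, ys ! j} \<in> E" using ys eq ij unfolding W_def by (metis hd_conv_nth)
      then show False using start ij by blast
    next
      case (Suc k)
      then have "{ys ! k, ys ! j} \<in> E"
        using ys eq ij successively_nth[of _ ys k] unfolding W_def by force
      then have "j = Suc k" using ind[of k j] ij Suc by simp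
      then show False using Suc ij by simp
    qed
  qed
  then have "distinct ys" unfolding distinct_conv_nth by (metis linorder_neqE_nat)
  then show thesis using that[of ys] ys start stop ind unfolding W_def by blast
qed

text \<open>For \<open>w\<close> in \<open>X\<close> this is the vertex set of the connected
  component of \<open>w\<close> in the subgraph induced by \<open>X\<close>. The closure is
  reflexive, so \<open>w\<close> always belongs to it.\<close>

definition component :: "'a set set \<Rightarrow> 'a set \<Rightarrow> 'a \<Rightarrow> 'a set" where
  "component E X w = {(x, y). x \<in> X \<and> y \<in> X \<and> {x, y} \<in> E}\<^sup>* `` {w}"

lemma component_self: "w \<in> component E X w"
  by (simp add: component_def)

lemma component_subset: "w \<in> X \<Longrightarrow> component E X w \<subseteq> X"
proof
  fix x assume w: "w \<in> X" and "x \<in> component E X w"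
  then have "(w, x) \<in> {(x, y). x \<in> X \<and> y \<in> X \<and> {x, y} \<in> E}\<^sup>*" by (simp add: component_def)
  then show "x \<in> X" by (induction rule: rtrancl_induct) (use w in auto)
qed

lemma component_closed:
  assumes "w \<in> X" "x \<in> component E X w" "{x, y} \<in> E" "y \<in> X"
  shows "y \<in> component E X w"
proof -
  have "x \<in> X" using component_subset[OF assms(1)] assms(2) by (rule subsetD)
  then have "(x, y) \<in> {(x, y). x \<in> X \<and> y \<in> X \<and> {x, y} \<in> E}"
    using assms(3,4) by simp
  with assms(2) show ?thesis unfolding component_def Image_singleton_iff
    by (rule rtrancl_into_rtrancl)
qed

lemma component_walk:
  assumes "x \<in> component E X w" "y \<in> component E X w"
  obtains xs where "xs \<noteq> []" "set xs \<subseteq> component E X w"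
    "successively (\<lambda>x y. {x, y} \<in> E) xs" "hd xs = x" "last xs = y"
proof -
  define R where "R = {(x, y). x \<in> X \<and> y \<in> X \<and> {x, y} \<in> E}"
  have "sym R" unfolding R_def sym_def by (auto simp: insert_commute)
  have wx: "(w, x) \<in> R\<^sup>*" and wy: "(w, y) \<in> R\<^sup>*"
    using assms unfolding component_def R_def[symmetric] by simp_all
  \<comment> \<open>By symmetry the way from \<open>w\<close> to \<open>x\<close> can be reversed;
    it is then continued from \<open>w\<close> to \<open>y\<close>.\<close>
  have "(x, w) \<in> R\<^sup>*" using sym_rtrancl[OF \<open>sym R\<close>] wx by (rule symD)
  then have "(x, y) \<in> R\<^sup>*" using wy by (rule rtrancl_trans)
  then have "\<exists>xs. xs \<noteq> [] \<and> set xs \<subseteq> component E X w \<and>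
    successively (\<lambda>x y. {x, y} \<in> E) xs \<and> hd xs = x \<and> last xs = y"
  proof (induction rule: rtrancl_induct)
    case base
    then show ?case using assms by (intro exI[of _ "[x]"]) auto
  next
    case (step y z)
    then obtain xs where xs: "xs \<noteq> []" "set xs \<subseteq> component E X w"
      "successively (\<lambda>x y. {x, y} \<in> E) xs" "hd xs = x" "last xs = y" by blast
    have "z \<in> component E X w"
      using rtrancl_trans[OF wx step(1)] step(2)
      unfolding component_def R_def[symmetric] by simp
    moreover have "{y, z} \<in> E" using step(2) unfolding R_def by auto
    ultimately show ?case using xs
      by (intro exI[of _ "xs @ [z]"]) (simp add: successively_append_iff)
  qed
  then show thesis using that by blast
qed

text \<open>The vertices \<open>a\<close> and \<open>b\<close> split the cycle into two paths. Both
  have inner vertices because \<open>a\<close> and \<open>b\<close> are not adjacent, and the ear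
  \<open>R\<close> is the third path.\<close>

lemma cycle_with_ear_K23_subdivision:
  assumes C: "successively (\<lambda>x y. {x, y} \<in> E) C" "distinct C" "C \<noteq> []" "{hd C, last C} \<in> E"
    and ab: "a \<in> set C" "b \<in> set C" "a \<noteq> b" "{a, b} \<notin> E"
    and R: "R \<noteq> []" "set R \<inter> set C = {}" "distinct R" "successively (\<lambda>x y. {x, y} \<in> E) R"
      "{a, hd R} \<in> E" "{last R, b} \<in> E"
  shows "\<exists>a b P Q R. K23_subdivision E a b P Q R"
proof -
  \<comment> \<open>It suffices to treat the case that \<open>a\<close> comes before
    \<open>b\<close> in the list; otherwise the two are exchanged and the ear is reversed.\<close>
  have ordered: ?thesis
    if CC: "C = C1 @ a # P @ b # C3" and ab: "{a, b} \<notin> E"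
      and R: "R \<noteq> []" "set R \<inter> set C = {}" "distinct R" "successively (\<lambda>x y. {x, y} \<in> E) R"
        "{a, hd R} \<in> E" "{last R, b} \<in> E"
    for a b C1 P C3 R
  proof -
    have s: "successively (\<lambda>x y. {x, y} \<in> E) (C1 @ [a])"
      "successively (\<lambda>x y. {x, y} \<in> E) (b # C3)"
      "successively (\<lambda>x y. {x, y} \<in> E) (a # P @ [b])"
      using C(1) unfolding CC by (auto simp: successively_append_iff successively_Cons hd_append
          split: if_splits)
    have e: "{hd (C1 @ [a]), last (b # C3)} \<in> E"
      using C(4) unfolding CC by (cases C1) auto
    \<comment> \<open>From \<open>a\<close> backwards to the head of \<open>C\<close>, over the
      closing edge to its last vertex, and backwards on to \<open>b\<close>.\<close>
    let ?Q = "rev C1 @ rev C3"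
    have sr: "successively (\<lambda>x y. {x, y} \<in> E) (rev (C1 @ [a]))"
      "successively (\<lambda>x y. {x, y} \<in> E) (rev (b # C3))"
      using s(1,2) by (simp_all only: successively_rev insert_commute)
    have "successively (\<lambda>x y. {x, y} \<in> E) (rev (C1 @ [a]) @ rev (b # C3))"
      using sr e by (simp only: successively_append_iff last_rev hd_rev) simp
    then have Q: "successively (\<lambda>x y. {x, y} \<in> E) (a # ?Q @ [b])" by simp
    have "P \<noteq> []" using s(3) ab by auto
    moreover have "?Q \<noteq> []" using e ab by auto
    moreover have "successively (\<lambda>x y. {x, y} \<in> E) (a # R @ [b])"
      using R by (simp add: successively_append_iff successively_Cons)
    ultimately have "K23_subdivision E a b P ?Q R"
      using s(3) Q R C(2) unfolding K23_subdivision_def path_edges_subset_iff CC by auto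
    then show ?thesis by blast
  qed
  obtain C1 C' where C': "C = C1 @ a # C'" using ab(1) by (meson split_list)
  show ?thesis
  proof (cases "b \<in> set C'")
    case True
    then obtain P C3 where "C' = P @ b # C3" by (meson split_list)
    then show ?thesis using ordered[of C1 a P b C3 R] C' ab R by simp
  next
    case False
    then have "b \<in> set C1" using ab C' by auto
    then obtain C0 P where "C1 = C0 @ b # P" by (meson split_list)
    moreover have "successively (\<lambda>x y. {x, y} \<in> E) (rev R)"
      using R(4) by (simp only: successively_rev insert_commute)
    ultimately show ?thesis using ordered[of C0 b P a C' "rev R"] C' ab R
      by (simp add: hd_rev last_rev insert_commute)
  qed
qed

section \<open>Minimal lobes and threads\<close>

text \<open>Provides four consecutive vertices of degree two, listed together with their two outer
  neighbors; they are a stretch of a chordless cycle through a minimal lobe.\<close>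

lemma thread_if_no_leaf:
  assumes fin: "finite V" and ne: "V \<noteq> {}" and EV: "\<And>e. e \<in> E \<Longrightarrow> e \<subseteq> V"
    and E2: "\<And>e. e \<in> E \<Longrightarrow> card e = 2"
    and K: "\<And>a b P Q R. \<not> K23_subdivision E a b P Q R"
    and girth: "\<And>xs. is_cycle E xs \<Longrightarrow> length xs \<ge> 6"
    and no_leaf: "\<And>w t. w \<in> V \<Longrightarrow> \<not> neighborhood E w \<subseteq> {t}"
  obtains C where "length C = 6" "distinct C" "set C \<subseteq> V"
    "\<And>i. i \<in> {1..4} \<Longrightarrow> neighborhood E (C ! i) = {C ! (i - 1), C ! (i + 1)}"
proof -
  have loop: "{x, x} \<notin> E" for x using E2[of "{x, x}"] by auto
  have N: "y \<in> neighborhood E x \<longleftrightarrow> {x, y} \<in> E" for x y by (simp add: neighborhood_def)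
  define lobe where "lobe S u v \<longleftrightarrow> S \<noteq> {} \<and> S \<subseteq> V \<and> u \<in> V \<and> v \<in> V \<and> u \<notin> S \<and> v \<notin> S \<and>
    (u = v \<or> {u, v} \<in> E) \<and> (\<forall>x\<in>S. neighborhood E x \<subseteq> S \<union> {u, v})" for S u v
  obtain w0 where w0: "w0 \<in> V" using ne by blast
  have NV: "neighborhood E x \<subseteq> V" for x using EV N by blast
  have "V - {w0} \<noteq> {}" using no_leaf[OF w0, of w0] NV[of w0] by blast
  \<comment> \<open>Removing any one vertex leaves a lobe, so a smallest one exists.\<close>
  then have "lobe (V - {w0}) w0 w0" using w0 NV unfolding lobe_def by blast
  then obtain S where S: "\<exists>u v. lobe S u v"
    and min: "\<And>T. \<exists>u v. lobe T u v \<Longrightarrow> card S \<le> card T"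
    using ex_has_least_nat[of "\<lambda>S. \<exists>u v. lobe S u v" "V - {w0}" card] by blast
  then obtain u v where uv: "lobe S u v" by blast
  have SV: "S \<noteq> {}" "S \<subseteq> V" "u \<in> V" "v \<in> V" "u \<notin> S" "v \<notin> S" "u = v \<or> {u, v} \<in> E"
    and NS: "\<And>x. x \<in> S \<Longrightarrow> neighborhood E x \<subseteq> S \<union> {u, v}"
    using uv unfolding lobe_def by blast+
  have finS: "finite S" using SV fin finite_subset by blast
  have smaller: "\<not> lobe T s t" if "T \<subset> S" for T s t
    using min[of T] psubset_card_mono[OF finS that] by force
  \<comment> \<open>If a single vertex \<open>t\<close> separated \<open>S\<close>, then moving one
    vertex \<open>w\<close> of \<open>S\<close> to the attachment side would give a smaller lobe:
    \<open>w\<close> is a neighbor of \<open>t\<close> if there is one, and otherwise alone suffices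
    as attachment. Something remains in the lobe since \<open>w\<close> is not a leaf.\<close>
  have no_cut: False if t: "t \<in> V" "t \<notin> S" and Nt: "\<And>x. x \<in> S \<Longrightarrow> neighborhood E x \<subseteq> S \<union> {t}" for t
  proof -
    obtain w where w: "w \<in> S" and wt: "{w, t} \<in> E \<or> (\<forall>x\<in>S. {x, t} \<notin> E)" using SV(1) by blast
    have "neighborhood E w \<subseteq> S - {w} \<union> {t}" using Nt[OF w] N loop by blast
    then have "S - {w} \<noteq> {}" using no_leaf[of w t] w SV by blast
    then show False
    proof (cases "{w, t} \<in> E")
      case True
      have "lobe (S - {w}) w t" using Nt w t SV \<open>S - {w} \<noteq> {}\<close> True unfolding lobe_def by blast
      then show False using smaller w by blast
    next
      case False
      then have "neighborhood E x \<subseteq> S" if "x \<in> S" for x using wt Nt[OF that] N that by blast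
      then have "lobe (S - {w}) w w" using w SV \<open>S - {w} \<noteq> {}\<close> unfolding lobe_def by blast
      then show False using smaller w by blast
    qed
  qed
  obtain x0 where x0: "x0 \<in> S" "{x0, u} \<in> E" using no_cut[of v] NS SV N by blast
  obtain x1 where x1: "x1 \<in> S" "{x1, v} \<in> E" using no_cut[of u] NS SV N by blast
  have uvE: "{u, v} \<in> E" using no_cut[of u] NS SV by blast
  \<comment> \<open>A component of \<open>S\<close> has the same attachments and is itself a lobe,
    so minimality makes \<open>S\<close> connected.\<close>
  have "component E S x0 = S"
  proof (rule ccontr)
    assume "component E S x0 \<noteq> S"
    then have "component E S x0 \<subset> S" using component_subset[OF x0(1), of E] by blast
    moreover from this have "lobe (component E S x0) u v"
      using SV NS component_closed[OF x0(1)] component_self[of x0 E S] N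
      unfolding lobe_def by blast
    ultimately show False using smaller by blast
  qed
  then have conn: "component E S x0 \<subseteq> S" "x1 \<in> component E S x0" using x1 by simp_all
  obtain xs where xs: "xs \<noteq> []" "set xs \<subseteq> component E S x0"
    "successively (\<lambda>x y. {x, y} \<in> E) xs" "hd xs = x0" "last xs = x1"
    using component_walk[OF component_self conn(2)] by blast
  have ends: "{u, hd xs} \<in> E" "{last xs, v} \<in> E"
    using xs x0 x1 by (simp_all add: insert_commute)
  obtain ys where ys: "ys \<noteq> []" "set ys \<subseteq> S" "successively (\<lambda>x y. {x, y} \<in> E) ys"
    "{u, hd ys} \<in> E" "{last ys, v} \<in> E" "distinct ys"
    and ind: "\<And>i j. i < j \<Longrightarrow> j < length ys \<Longrightarrow> {ys ! i, ys ! j} \<in> E \<Longrightarrow> j = Suc i"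
    and start: "\<And>i. i < length ys \<Longrightarrow> {u, ys ! i} \<in> E \<Longrightarrow> i = 0"
    and stop: "\<And>i. i < length ys \<Longrightarrow> {ys ! i, v} \<in> E \<Longrightarrow> Suc i = length ys"
    by (rule shortest_walk[OF xs(1) subset_trans[OF xs(2) conn(1)] xs(3) ends]) (rule that)
  let ?C = "u # ys @ [v]"
  have "u \<noteq> v" using uvE loop by blast
  then have Cd: "distinct ?C" using ys SV by auto
  have Cs: "successively (\<lambda>x y. {x, y} \<in> E) ?C"
    using ys by (simp add: successively_append_iff successively_Cons)
  have "is_cycle E ?C"
    unfolding is_cycle_def
  proof (intro conjI allI impI)
    show "3 \<le> length ?C" using ys(1) by (cases ys) auto
    fix i assume i: "i < length ?C"
    show "{?C ! i, ?C ! (Suc i mod length ?C)} \<in> E"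
    proof (cases "Suc i = length ?C")
      case True
      then have "?C ! i = v" by (simp add: nth_append)
      then show ?thesis using True uvE by (simp add: insert_commute)
    next
      case False
      then have "Suc i < length ?C" using i by simp
      then show ?thesis using successively_nth[OF Cs, of i] by simp
    qed
  qed (fact Cd)
  \<comment> \<open>The girth bound also counts \<open>u\<close> and \<open>v\<close>, which leaves
    four vertices for \<open>ys\<close>.\<close>
  then have len: "length ys \<ge> 4" using girth[of ?C] by simp
  have "S \<subseteq> set ys"
  proof
    fix w assume w: "w \<in> S"
    show "w \<in> set ys"
    proof (rule ccontr)
      assume wy: "w \<notin> set ys"
      define X where "X = S - set ys"
      have wX: "w \<in> X" using w wy X_def by blast
      define D where "D = component E X w"
      have DX: "D \<subseteq> X" using component_subset[OF wX] D_def by blast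
      have "w \<in> D" using component_self D_def by metis
      have "hd ys \<in> S" using ys by auto
      then have DS: "D \<subset> S" using DX ys(1) unfolding X_def by auto
      \<comment> \<open>The attachments on the cycle of a component \<open>D\<close> of
        \<open>S\<close> without \<open>ys\<close>. If they fit into one vertex or one edge, then
        \<open>D\<close> is a smaller lobe.\<close>
      define A where "A = {a \<in> set ?C. \<exists>x\<in>D. {x, a} \<in> E}"
      have ND: "neighborhood E x \<subseteq> D \<union> A" if x: "x \<in> D" for x
      proof
        fix y assume "y \<in> neighborhood E x"
        then have y: "{x, y} \<in> E" by (simp add: N)
        have "y \<in> S \<union> {u, v}" using NS[of x] x DS y N by blast
        moreover have "y \<in> D" if "y \<in> X"
          using component_closed[OF wX _ y that] x D_def by blast
        ultimately show "y \<in> D \<union> A" using x y unfolding A_def X_def by auto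
      qed
      have AV: "A \<subseteq> V" "A \<inter> D = {}" using ys SV DX unfolding A_def X_def by auto
      have not_pair: "\<not> A \<subseteq> {s, t}" if "s \<in> A" "t \<in> A" "s = t \<or> {s, t} \<in> E" for s t
      proof
        assume "A \<subseteq> {s, t}"
        then have "lobe D s t" using ND that AV \<open>w \<in> D\<close> DS SV unfolding lobe_def by blast
        then show False using smaller DS by blast
      qed
      have "A \<noteq> {}"
      proof
        assume "A = {}"
        \<comment> \<open>With no attachments at all, \<open>u\<close> is only a
          placeholder.\<close>
        then have "lobe D u u" using ND \<open>w \<in> D\<close> DS SV unfolding lobe_def by blast
        then show False using smaller DS by blast
      qed
      then obtain s where s: "s \<in> A" by blast
      then obtain t where t: "t \<in> A" "t \<noteq> s" using not_pair[of s s] by blast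
      \<comment> \<open>If \<open>s\<close> and \<open>t\<close> are adjacent, there is a third
        attachment, and it cannot be adjacent to both because that would be a triangle.\<close>
      have "\<exists>a\<in>A. \<exists>b\<in>A. a \<noteq> b \<and> {a, b} \<notin> E"
      proof (cases "{s, t} \<in> E")
        case True
        then obtain r where r: "r \<in> A" "r \<noteq> s" "r \<noteq> t" using not_pair[of s t] s t by blast
        have "{t, r} \<notin> E \<or> {r, s} \<notin> E"
        proof (rule ccontr)
          assume "\<not> ?thesis"
          then have tri: "{s, t} \<in> E" "{t, r} \<in> E" "{r, s} \<in> E" "distinct [s, t, r]"
            using True r t by auto
          then have "is_cycle E [s, t, r]"
            unfolding is_cycle_def by (simp add: All_less_Suc)
          then show False using girth[of "[s, t, r]"] by simp
        qed
        then show ?thesis using r(1-3) s t(1) by metis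
      next
        case False
        then show ?thesis using s t by metis
      qed
      then obtain a b where ab: "a \<in> A" "b \<in> A" "a \<noteq> b" "{a, b} \<notin> E" by blast
      obtain d e where de: "d \<in> D" "{d, a} \<in> E" "e \<in> D" "{e, b} \<in> E"
        using ab unfolding A_def by blast
      obtain zs where zs: "zs \<noteq> []" "set zs \<subseteq> D" "successively (\<lambda>x y. {x, y} \<in> E) zs"
        "hd zs = d" "last zs = e"
        using component_walk[OF de(1)[unfolded D_def] de(3)[unfolded D_def]] unfolding D_def by blast
      have zends: "{a, hd zs} \<in> E" "{last zs, b} \<in> E"
        using zs de by (simp_all add: insert_commute)
      obtain R where R: "R \<noteq> []" "set R \<subseteq> D" "successively (\<lambda>x y. {x, y} \<in> E) R"
        "{a, hd R} \<in> E" "{last R, b} \<in> E" "distinct R"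
        by (rule shortest_walk[OF zs(1-3) zends]) (rule that)
      have "set R \<inter> set ?C = {}" using R(2) DX SV unfolding X_def by auto
      then show False
        using cycle_with_ear_K23_subdivision[OF Cs Cd _ _ _ _ ab(3,4) R(1) _ R(6,3,4,5)] K ab uvE
        unfolding A_def by simp
    qed
  qed
  then have Sy: "S = set ys" using ys by blast
  \<comment> \<open>The index is shifted because \<open>ys ! i\<close> is entry \<open>Suc i\<close>
    of the cycle. All neighbors lie on the cycle, and it has no chord at this vertex by
    \<open>start\<close>, \<open>stop\<close> and \<open>ind\<close>.\<close>
  have nb: "neighborhood E (?C ! Suc i) = {?C ! i, ?C ! Suc (Suc i)}" if i: "i < length ys" for i
  proof
    show "{?C ! i, ?C ! Suc (Suc i)} \<subseteq> neighborhood E (?C ! Suc i)"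
      using successively_nth[OF Cs, of i] successively_nth[OF Cs, of "Suc i"] i N
      by (simp add: insert_commute)
    show "neighborhood E (?C ! Suc i) \<subseteq> {?C ! i, ?C ! Suc (Suc i)}"
    proof
      fix y assume "y \<in> neighborhood E (?C ! Suc i)"
      then have y: "{ys ! i, y} \<in> E" using i by (simp add: N nth_append)
      then have "y \<in> set ys \<union> {u, v}" using NS[of "ys ! i"] i N Sy by auto
      then consider "y = u" | "y = v" | j where "y = ys ! j" "j < length ys"
        by (auto simp: in_set_conv_nth)
      then show "y \<in> {?C ! i, ?C ! Suc (Suc i)}"
      proof cases
        case 1
        then show ?thesis using start[OF i] y by (simp add: insert_commute)
      next
        case 2
        then have "Suc i = length ys" using stop[OF i] y by simp
        then show ?thesis using 2 by (simp add: nth_append)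
      next
        case 3
        have "j \<noteq> i" using y 3 loop by auto
        then consider "i < j" | "j < i" by linarith
        then show ?thesis
        proof cases
          case 1
          then have "j = Suc i" using ind 3 y by blast
          then show ?thesis using 3 by (simp add: nth_append)
        next
          case 2
          then have "i = Suc j" using ind[of j i] 3 y i by (simp add: insert_commute)
          then show ?thesis using 3 by (simp add: nth_append)
        qed
      qed
    qed
  qed
  show thesis
  \<comment> \<open>Positions 1 to 4 are entries of \<open>ys\<close>, since \<open>ys\<close> has
    at least four; position 5 may already be \<open>v\<close>.\<close>
  proof (rule that[of "take 6 ?C"])
    show "length (take 6 ?C) = 6" using len by simp
    show "distinct (take 6 ?C)" using Cd by (rule distinct_take)
    show "set (take 6 ?C) \<subseteq> V" using set_take_subset[of 6 ?C] ys SV by auto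
    fix i :: nat assume i: "i \<in> {1..4}"
    then have "neighborhood E (?C ! Suc (i - 1)) = {?C ! (i - 1), ?C ! Suc (Suc (i - 1))}"
      using len by (intro nb) auto
    moreover have "Suc (i - 1) = i" "i < 5" using i by auto
    ultimately show "neighborhood E (take 6 ?C ! i) = {take 6 ?C ! (i - 1), take 6 ?C ! (i + 1)}"
      by (simp only: nth_take) simp
  qed
qed

section \<open>Extending colorings\<close>

lemma two_colors_avoidable:
  fixes A B :: nat
  obtains x where "x < 4" "x \<noteq> A" "x \<noteq> B"
proof -
  have "card {A, B} < card {..<4::nat}" by (simp add: card_insert_if)
  then have "\<not> {..<4} \<subseteq> {A, B}" by (meson card_mono finite.intros leD)
  then show thesis using that by blast
qed

text \<open>Here \<open>A\<close> and \<open>B\<close> are the colors of the outer neighbors, and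
  \<open>F\<close> and \<open>G\<close> are colors these see exactly once. Beyond properness, colors
  at distance two along the thread must differ, so that each thread vertex sees two distinct colors.
  The finitely many cases are evaluated.\<close>

lemma thread_colors:
  fixes A B F G :: nat
  assumes "A < 4" "B < 4"
  obtains x1 x2 x3 x4 where "x1 < 4" "x2 < 4" "x3 < 4" "x4 < 4"
    "x1 \<noteq> A" "x1 \<noteq> F" "x2 \<noteq> A" "x2 \<noteq> x1" "x3 \<noteq> x1" "x3 \<noteq> x2" "x3 \<noteq> B"
    "x4 \<noteq> x2" "x4 \<noteq> x3" "x4 \<noteq> B" "x4 \<noteq> G"
proof -
  have "\<forall>A\<in>{0,1,2,3::nat}. \<forall>B\<in>{0,1,2,3}. \<forall>F\<in>{0,1,2,3}. \<forall>G\<in>{0,1,2,3}.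
    \<exists>x1\<in>{0,1,2,3}. x1 \<noteq> A \<and> x1 \<noteq> F \<and> (\<exists>x2\<in>{0,1,2,3}. x2 \<noteq> A \<and> x2 \<noteq> x1 \<and>
    (\<exists>x3\<in>{0,1,2,3}. x3 \<noteq> x1 \<and> x3 \<noteq> x2 \<and> x3 \<noteq> B \<and>
    (\<exists>x4\<in>{0,1,2,3}. x4 \<noteq> x2 \<and> x4 \<noteq> x3 \<and> x4 \<noteq> B \<and> x4 \<noteq> G)))"
    by code_simp
  moreover have four: "x \<in> {0,1,2,3} \<longleftrightarrow> x < 4" for x :: nat by auto
  ultimately have *: "\<exists>x1<4. x1 \<noteq> A \<and> x1 \<noteq> F \<and> (\<exists>x2<4. x2 \<noteq> A \<and> x2 \<noteq> x1 \<and>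
    (\<exists>x3<4. x3 \<noteq> x1 \<and> x3 \<noteq> x2 \<and> x3 \<noteq> B \<and>
    (\<exists>x4<4. x4 \<noteq> x2 \<and> x4 \<noteq> x3 \<and> x4 \<noteq> B \<and> x4 \<noteq> G)))"
    if "A < 4" "B < 4" "F < 4" "G < 4" for A B F G :: nat
    using that unfolding Ball_def Bex_def four by simp
  \<comment> \<open>The values \<open>F\<close> and \<open>G\<close> need not be below 4. A larger
    one forbids nothing, so 0 can stand in for it.\<close>
  define F' where "F' = (if F < 4 then F else 0)"
  define G' where "G' = (if G < 4 then G else 0)"
  have "F' < 4" "G' < 4" by (simp_all add: F'_def G'_def)
  from *[OF assms this] obtain x1 x2 x3 x4 where "x1 < 4" "x2 < 4" "x3 < 4" "x4 < 4"
    "x1 \<noteq> A" "x1 \<noteq> F'" "x2 \<noteq> A" "x2 \<noteq> x1" "x3 \<noteq> x1" "x3 \<noteq> x2" "x3 \<noteq> B"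
    "x4 \<noteq> x2" "x4 \<noteq> x3" "x4 \<noteq> B" "x4 \<noteq> G'" by blast
  moreover from this have "x1 \<noteq> F" "x4 \<noteq> G" by (auto simp: F'_def G'_def split: if_splits)
  ultimately show thesis using that by blast
qed

text \<open>A neighborhood that gains at most the vertex \<open>z\<close> keeps its unique color
  \<open>a\<close> if \<open>z\<close> avoids \<open>a\<close>. If it was empty before,
  \<open>z\<close> is the only neighbor and its own color is unique.\<close>

lemma unique_color_extend:
  assumes "M \<subseteq> N" "N \<subseteq> insert z M" "N \<noteq> {}"
    and "\<And>y. y \<in> M \<Longrightarrow> c y = c' y"
    and "M \<noteq> {} \<Longrightarrow> \<exists>!y. y \<in> M \<and> c' y = a"
    and "z \<in> N \<Longrightarrow> z \<notin> M \<Longrightarrow> c z \<noteq> a"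
  shows "\<exists>a. \<exists>!y. y \<in> N \<and> c y = a"
proof (cases "M = {}")
  case True
  then have "N = {z}" using assms(2,3) by auto
  then show ?thesis by auto
next
  case False
  then have ex: "\<exists>!y. y \<in> M \<and> c' y = a" by (rule assms(5))
  then obtain y where y: "y \<in> M" "c' y = a" by blast
  have uniq: "x = y" if "x \<in> M" "c' x = a" for x using ex y that by blast
  have "\<exists>!y. y \<in> N \<and> c y = a"
  proof (rule ex1I[of _ y])
    show "y \<in> N \<and> c y = a" using y assms(1,4) by auto
    fix x assume x: "x \<in> N \<and> c x = a"
    then have "x \<in> M" using assms(2,6) by auto
    then show "x = y" using uniq assms(4) x by simp
  qed
  then show ?thesis by blast
qed

lemma unique_color_pair:
  assumes "N = {y, z}" "c y \<noteq> c z"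
  shows "\<exists>a. \<exists>!y. y \<in> N \<and> c y = a"
  using assms by (intro exI[of _ "c y"] ex1I[of _ y]) auto

lemma pcf_colorableE:
  assumes "pcf_colorable V E k"
  obtains c :: "'a \<Rightarrow> nat" and f where "c ` V \<subseteq> {..<k}" "proper_coloring E c"
    "\<And>x. x \<in> V \<Longrightarrow> neighborhood E x \<noteq> {} \<Longrightarrow> \<exists>!y. y \<in> neighborhood E x \<and> c y = f x"
proof -
  obtain c :: "'a \<Rightarrow> nat" where c: "c ` V \<subseteq> {..<k}" "proper_coloring E c"
    "conflict_free_coloring V E c" using assms unfolding pcf_colorable_def by blast
  \<comment> \<open>The premises stand below the quantifier so that the choice function is total; at
    isolated vertices its value is arbitrary.\<close>
  have "\<forall>x. \<exists>a. x \<in> V \<longrightarrow> neighborhood E x \<noteq> {} \<longrightarrow> (\<exists>!y. y \<in> neighborhood E x \<and> c y = a)"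
    using c(3) unfolding conflict_free_coloring_def by blast
  then obtain f where "\<forall>x. x \<in> V \<longrightarrow> neighborhood E x \<noteq> {} \<longrightarrow>
      (\<exists>!y. y \<in> neighborhood E x \<and> c y = f x)" by (rule choice[THEN exE])
  then show thesis using that c by blast
qed

text \<open>Only \<open>t\<close> can notice the new vertex. Avoiding \<open>c t\<close> keeps the
  coloring proper, and avoiding \<open>f t\<close> keeps that color unique around \<open>t\<close>.
  An isolated \<open>w\<close> is covered too.\<close>

lemma pcf_colorable_add_leaf:
  assumes EV: "\<And>e. e \<in> E \<Longrightarrow> e \<subseteq> V" and E2: "\<And>e. e \<in> E \<Longrightarrow> card e = 2"
    and w: "w \<in> V" "neighborhood E w \<subseteq> {t}"
    and col: "pcf_colorable (V - {w}) {e \<in> E. e \<subseteq> V - {w}} 4"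
  shows "pcf_colorable V E 4"
proof -
  let ?E = "{e \<in> E. e \<subseteq> V - {w}}"
  have loop: "{x, x} \<notin> E" for x using E2[of "{x, x}"] by auto
  have N': "neighborhood ?E x = neighborhood E x - {w}" if "x \<noteq> w" for x
    using that EV by (auto simp: neighborhood_def)
  have wt: "y = t" if "{w, y} \<in> E" for y using w(2) that by (auto simp: neighborhood_def)
  obtain c f where c: "c ` (V - {w}) \<subseteq> {..<4::nat}" "proper_coloring ?E c"
    and f: "\<And>x. x \<in> V - {w} \<Longrightarrow> neighborhood ?E x \<noteq> {} \<Longrightarrow>
      \<exists>!y. y \<in> neighborhood ?E x \<and> c y = f x"
    by (rule pcf_colorableE[OF col]) (rule that)
  obtain k where k: "k < 4" "k \<noteq> c t" "k \<noteq> f t" using two_colors_avoidable .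
  define d where "d = c(w := k)"
  have "d ` V \<subseteq> {..<4}" using c(1) k(1) unfolding d_def by auto
  moreover have "proper_coloring E d"
    unfolding proper_coloring_def
  proof (intro allI impI)
    fix x y assume xy: "{x, y} \<in> E"
    consider "x = w" | "y = w" | "x \<noteq> w" "y \<noteq> w" by blast
    then show "d x \<noteq> d y"
    proof cases
      case 1
      then show ?thesis using wt[of y] xy loop k unfolding d_def by auto
    next
      case 2
      then have "x = t" using wt[of x] xy by (simp add: insert_commute)
      then show ?thesis using 2 xy loop k unfolding d_def by auto
    next
      case 3
      then have "{x, y} \<in> ?E" using xy EV by auto
      then show ?thesis using c(2) 3 unfolding proper_coloring_def d_def by auto
    qed
  qed
  moreover have "conflict_free_coloring V E d"
    unfolding conflict_free_coloring_def
  proof (intro ballI impI)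
    fix x assume x: "x \<in> V" "neighborhood E x \<noteq> {}"
    show "\<exists>a. \<exists>!y. y \<in> neighborhood E x \<and> d y = a"
    proof (cases "x = w")
      case True
      then have "neighborhood E x = {t}" using x w(2) by auto
      then show ?thesis by auto
    next
      case False
      show ?thesis
      proof (rule unique_color_extend[OF _ _ x(2)])
        show "neighborhood ?E x \<subseteq> neighborhood E x"
          "neighborhood E x \<subseteq> insert w (neighborhood ?E x)" using N'[OF False] by auto
        show "d y = c y" if "y \<in> neighborhood ?E x" for y
          using that N'[OF False] unfolding d_def by auto
        show "\<exists>!y. y \<in> neighborhood ?E x \<and> c y = f x" if "neighborhood ?E x \<noteq> {}"
          using f x False that by simp
        assume "w \<in> neighborhood E x"
        then have "x = t" using wt[of x] by (simp add: neighborhood_def insert_commute)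
        then show "d w \<noteq> f x" using k unfolding d_def by simp
      qed
    qed
  qed
  ultimately show ?thesis unfolding pcf_colorable_def by blast
qed

text \<open>The thread is colored by \<open>thread_colors\<close>. Outside it only \<open>u\<close>
  and \<open>v\<close> gain a neighbor, one each since they are distinct, and the new colors there
  avoid \<open>f u\<close> and \<open>f v\<close>.\<close>

lemma pcf_colorable_add_thread:
  assumes EV: "\<And>e. e \<in> E \<Longrightarrow> e \<subseteq> V"
    and dist: "distinct [u, x1, x2, x3, x4, v]" and uv: "{u, v} \<subseteq> V"
    and N1: "neighborhood E x1 = {u, x2}" and N2: "neighborhood E x2 = {x1, x3}"
    and N3: "neighborhood E x3 = {x2, x4}" and N4: "neighborhood E x4 = {x3, v}"
    and col: "pcf_colorable (V - {x1, x2, x3, x4}) {e \<in> E. e \<subseteq> V - {x1, x2, x3, x4}} 4"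
  shows "pcf_colorable V E 4"
proof -
  let ?X = "{x1, x2, x3, x4}"
  let ?E = "{e \<in> E. e \<subseteq> V - ?X}"
  have sym: "y \<in> neighborhood E x \<longleftrightarrow> x \<in> neighborhood E y" for x y
    by (simp add: neighborhood_def insert_commute)
  have N': "neighborhood ?E x = neighborhood E x - ?X" if "x \<notin> ?X" for x
    using that EV by (auto simp: neighborhood_def)
  obtain c f where c: "c ` (V - ?X) \<subseteq> {..<4::nat}" "proper_coloring ?E c"
    and f: "\<And>x. x \<in> V - ?X \<Longrightarrow> neighborhood ?E x \<noteq> {} \<Longrightarrow>
      \<exists>!y. y \<in> neighborhood ?E x \<and> c y = f x"
    by (rule pcf_colorableE[OF col]) (rule that)
  have "c u < 4" "c v < 4" using c(1) uv dist by auto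
  from this(1,2) obtain k1 k2 k3 k4 where k4: "k1 < 4" "k2 < 4" "k3 < 4" "k4 < 4"
    and k: "k1 \<noteq> c u" "k1 \<noteq> f u" "k2 \<noteq> c u" "k2 \<noteq> k1" "k3 \<noteq> k1" "k3 \<noteq> k2" "k3 \<noteq> c v"
    "k4 \<noteq> k2" "k4 \<noteq> k3" "k4 \<noteq> c v" "k4 \<noteq> f v"
    by (rule thread_colors[of "c u" "c v" "f u" "f v"]) (rule that)
  define d where "d = c(x1 := k1, x2 := k2, x3 := k3, x4 := k4)"
  have d: "d x1 = k1" "d x2 = k2" "d x3 = k3" "d x4 = k4" "d u = c u" "d v = c v"
    using dist by (auto simp: d_def)
  have dc: "d x = c x" if "x \<notin> ?X" for x using that by (simp add: d_def)
  have dX: "d x \<noteq> d y" if "x \<in> ?X" "y \<in> neighborhood E x" for x y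
    using that N1 N2 N3 N4 d k by auto
  have "d ` V \<subseteq> {..<4}" using c(1) k4 by (auto simp: d_def)
  moreover have "proper_coloring E d"
    unfolding proper_coloring_def
  proof (intro allI impI)
    fix x y assume "{x, y} \<in> E"
    then have xy: "y \<in> neighborhood E x" by (simp add: neighborhood_def)
    consider "x \<in> ?X" | "y \<in> ?X" | "x \<notin> ?X" "y \<notin> ?X" by blast
    then show "d x \<noteq> d y"
    proof cases
      case 1
      then show ?thesis using dX xy by blast
    next
      case 2
      then show ?thesis using dX[of y x] xy sym by auto
    next
      case 3
      then have "{x, y} \<in> ?E" using \<open>{x, y} \<in> E\<close> EV by auto
      then show ?thesis using c(2) 3 dc unfolding proper_coloring_def by simp
    qed
  qed
  moreover have "conflict_free_coloring V E d"
    unfolding conflict_free_coloring_def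
  proof (intro ballI impI)
    fix x assume x: "x \<in> V" "neighborhood E x \<noteq> {}"
    show "\<exists>a. \<exists>!y. y \<in> neighborhood E x \<and> d y = a"
    proof (cases "x \<in> ?X")
      case True
      then consider "x = x1" | "x = x2" | "x = x3" | "x = x4" by blast
      then show ?thesis
      proof cases
        case 1
        show ?thesis unfolding 1 by (rule unique_color_pair[OF N1]) (use d k in auto)
      next
        case 2
        show ?thesis unfolding 2 by (rule unique_color_pair[OF N2]) (use d k in auto)
      next
        case 3
        show ?thesis unfolding 3 by (rule unique_color_pair[OF N3]) (use d k in auto)
      next
        case 4
        show ?thesis unfolding 4 by (rule unique_color_pair[OF N4]) (use d k in auto)
      qed
    next
      case False
      \<comment> \<open>The only thread vertex that can be adjacent to \<open>x\<close>. If
        \<open>x\<close> is neither \<open>u\<close> nor \<open>v\<close>, it has no neighbor in the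
        thread and the value \<open>x4\<close> is a mere default.\<close>
      define z where "z = (if x = u then x1 else x4)"
      have att: "y = z \<and> (x = u \<or> x = v)" if "y \<in> neighborhood E x" "y \<in> ?X" for y
        using that False dist N1 N2 N3 N4 sym[of y x] by (auto simp: z_def)
      show ?thesis
      proof (rule unique_color_extend[OF _ _ x(2)])
        show "neighborhood ?E x \<subseteq> neighborhood E x"
          "neighborhood E x \<subseteq> insert z (neighborhood ?E x)" using N'[OF False] att by auto
        show "d y = c y" if "y \<in> neighborhood ?E x" for y
          using that N'[OF False] dc by blast
        show "\<exists>!y. y \<in> neighborhood ?E x \<and> c y = f x" if "neighborhood ?E x \<noteq> {}"
          using f x False that by simp
        assume "z \<in> neighborhood E x"
        moreover have "z \<in> ?X" by (simp add: z_def)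
        ultimately have "x = u \<or> x = v" using att by blast
        then show "d z \<noteq> f x" using k d dist by (auto simp: z_def)
      qed
    qed
  qed
  ultimately show ?thesis unfolding pcf_colorable_def by blast
qed

text \<open>The absence of such subdivisions and of short cycles passes to induced subgraphs, so
  induction on the number of vertices applies: a vertex with at most one neighbor is removed if
  there is one, and otherwise the inner vertices of a thread.\<close>

lemma pcf_4_colorable_if_no_K23_subdivision:
  assumes "finite V" and "\<And>e. e \<in> E \<Longrightarrow> e \<subseteq> V" and "\<And>e. e \<in> E \<Longrightarrow> card e = 2"
    and "\<And>a b P Q R. \<not> K23_subdivision E a b P Q R"
    and "\<And>xs. is_cycle E xs \<Longrightarrow> length xs \<ge> 6"
  shows "pcf_colorable V E 4"
  using assms
proof (induction "card V" arbitrary: V E rule: less_induct)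
  case less
  note fin = less.prems(1) and EV = less.prems(2) and E2 = less.prems(3)
    and K = less.prems(4) and girth = less.prems(5)
  have IH: "pcf_colorable (V - X) {e \<in> E. e \<subseteq> V - X} 4" if "x \<in> X" "x \<in> V" for X x
  proof (rule less.hyps)
    show "card (V - X) < card V" using that fin by (intro psubset_card_mono) auto
    show "\<not> K23_subdivision {e \<in> E. e \<subseteq> V - X} a b P Q R" for a b P Q R
      using K[of a b P Q R] unfolding K23_subdivision_def by auto
    show "length xs \<ge> 6" if "is_cycle {e \<in> E. e \<subseteq> V - X} xs" for xs
      using that by (intro girth) (auto simp: is_cycle_def)
  qed (use fin E2 in auto)
  show ?case
  proof (cases "V = {}")
    case True
    have "e \<notin> E" for e using EV[of e] E2[of e] True by auto
    then show ?thesis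
      using True by (simp add: pcf_colorable_def proper_coloring_def conflict_free_coloring_def)
  next
    case ne: False
    show ?thesis
    proof (cases "\<exists>w t. w \<in> V \<and> neighborhood E w \<subseteq> {t}")
      case True
      then obtain w t where w: "w \<in> V" "neighborhood E w \<subseteq> {t}" by (elim exE conjE)
      show ?thesis
        by (rule pcf_colorable_add_leaf[OF EV E2 w]) (assumption | rule IH[OF singletonI w(1)])+
    next
      case False
      then have no_leaf: "\<not> neighborhood E w \<subseteq> {t}" if "w \<in> V" for w t using that by blast
      obtain C where C: "length C = 6" "distinct C" "set C \<subseteq> V"
        "\<And>i. i \<in> {1..4} \<Longrightarrow> neighborhood E (C ! i) = {C ! (i - 1), C ! (i + 1)}"
        by (rule thread_if_no_leaf[OF fin ne EV E2 K girth no_leaf]) (assumption | rule that)+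
      obtain u x1 x2 x3 x4 v where Ceq: "C = [u, x1, x2, x3, x4, v]"
        using C(1) by (auto simp: numeral_eq_Suc length_Suc_conv)
      show ?thesis
      proof (rule pcf_colorable_add_thread[OF EV])
        show "distinct [u, x1, x2, x3, x4, v]" "{u, v} \<subseteq> V" using C(2,3) Ceq by auto
        show "neighborhood E x1 = {u, x2}" "neighborhood E x2 = {x1, x3}"
          "neighborhood E x3 = {x2, x4}" "neighborhood E x4 = {x3, v}"
          using C(4)[of 1] C(4)[of 2] C(4)[of 3] C(4)[of 4]
          by (simp_all add: Ceq numeral_eq_Suc)
        show "pcf_colorable (V - {x1, x2, x3, x4}) {e \<in> E. e \<subseteq> V - {x1, x2, x3, x4}} 4"
          by (rule IH[of x1]) (use C(3) Ceq in auto)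
      qed
    qed
  qed
qed

theorem theorem5p3:
  fixes V :: "'a set" and E :: "'a set set"
  assumes "simple_graph V E"
    and "outerplanar V E"
    and "girth E \<ge> 6"
  shows "pcf_colorable V E 4 \<and> pcf_chromatic_number V E \<le> 4"
proof -
  interpret simple_graph V E by fact
  have "length xs \<ge> 6" if "is_cycle E xs" for xs
  proof -
    have "girth E \<le> enat (length xs)"
      unfolding girth_def using that by (intro INF_lower) simp
    with assms(3) have "6 \<le> enat (length xs)" by (rule order_trans)
    then show ?thesis by (simp add: numeral_eq_enat)
  qed
  then have "pcf_colorable V E 4"
    using finite_vertices edge_subset edge_card
      outerplanar_no_K23_subdivision[OF assms(2) edge_subset]
    by (intro pcf_4_colorable_if_no_K23_subdivision) simp_all
  then show ?thesis using pcf_chromatic_number_le_iff by simp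
qed

end
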